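(* Let $N\ge1$, let $(a_{ij})_{1\le i,j\le N}$ be a symmetric matrix with nonnegative entries, and let $m_i,\gamma_i\in\mathbb{R}$ and $(\theta_i^{in},\omega_i^{in})_{i=1}^N\in\mathbb{R}^N\times\mathbb{R}^N$. Suppose that there exist $\bar a>0$ and $\delta\ge0$ such that $$m_i>0,\quad \gamma_i>0,\quad \sum_{j=1}^N|a_{ij}-\bar a|\le\delta\quad\text{for all } i=1,\dots,N,$$ $$\text{and}\quad \sum_{i,j=1}^N a_{ij}\cos(\theta_i^{in}-\theta_j^{in})\ \ge\ \sum_{i=1}^N m_i|\omega_i^{in}|^2+3\delta N+\frac{\delta^2}{\bar a}.$$ Let $\Theta=(\theta_1,\dots,\theta_N)$, with $\omega_i=\dot\theta_i$, be the solution of $$m_i\ddot\theta_i=-\gamma_i\dot\theta_i+\sum_{j=1}^N a_{ij}\sin(\theta_j-\theta_i),\quad t>0,\quad i=1,\dots,N,$$ with initial data $(\theta_i,\dot\theta_i)(0)=(\theta_i^{in},\omega_i^{in})$. Then the following assertions hold. (1) Complete synchronization emerges asymptotically: $\lim_{t\to\infty}|\omega_i(t)-\omega_j(t)|=0$ for all $1\le i,j\le N$. (2) If $\sum_{i,j=1}^N a_{ij}\cos(\theta_i^{in}-\theta_j^{in})=0$, then the system stays as a phase-locked state and $R_{p,i}(\Theta(t))=0$ for all $t\ge0$ and all $i$. (3) If $\sum_{i,j=1}^N a_{ij}\cos(\theta_i^{in}-\theta_j^{in})>0$, then there exists a constant $R_*>0$ such that $R_{p,i}(\Theta(t))\ge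 R_*$ for all $t\ge0$ and all $i$, and for each $i$ there is $k_i\in\mathbb{Z}$ such that $\theta_i(t)-\varphi_{p,i}(t)\to k_i\pi$ as $t\to\infty$.
   Context: The system is regarded as a dynamical system on $\mathbb{R}^N\times\mathbb{R}^N$. The local order parameter $R_{p,i}(t)=R_{p,i}(\Theta(t))\ge0$ and local average phase $\varphi_{p,i}(t)$ are defined by $R_{p,i}(t)e^{\mathrm{i}\varphi_{p,i}(t)}=\sum_{j=1}^N a_{ij}e^{\mathrm{i}\theta_j(t)}$; when $R_{p,i}(t)>0$ for all $t$, $\varphi_{p,i}$ is taken to be a continuous real-valued function of $t$. A solution $\Theta(t)$ is a phase-locked state if $|\theta_i(t)-\theta_j(t)|=|\theta_i^{in}-\theta_j^{in}|$ for all $i,j$ and all $t\ge0$. *)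

theory Defs
  imports "HOL-Analysis.Analysis"
begin

text \<open>A trajectory is a pair of maps \<open>\<theta> \<omega> :: real \<Rightarrow> real ^ 'n\<close> with \<open>N = CARD('n)\<close>;
  only its values at times \<open>t \<ge> 0\<close> matter.  The system is imposed for \<open>t > 0\<close>; at \<open>t = 0\<close> the
  derivative of \<open>\<theta>\<close> is one-sided, and \<open>\<omega>\<close> is continuous up to \<open>t = 0\<close>.\<close>

definition inertial_kuramoto_solution ::
  "real ^ 'n \<Rightarrow> real ^ 'n \<Rightarrow> real ^ 'n ^ 'n \<Rightarrow> real ^ 'n \<Rightarrow> real ^ 'n \<Rightarrow>
   (real \<Rightarrow> real ^ 'n) \<Rightarrow> (real \<Rightarrow> real ^ 'n) \<Rightarrow> bool"
  where "inertial_kuramoto_solution m \<gamma> a \<theta>in \<omega>in \<theta> \<omega> \<longleftrightarrow>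
    \<theta> 0 = \<theta>in \<and> \<omega> 0 = \<omega>in \<and>
    (\<forall>t\<ge>0. (\<theta> has_vector_derivative \<omega> t) (at t within {0..})) \<and>
    continuous_on {0..} \<omega> \<and>
    (\<forall>t>0. \<exists>\<omega>'. (\<omega> has_vector_derivative \<omega>') (at t) \<and>
      (\<forall>i. m $ i * \<omega>' $ i =
        - \<gamma> $ i * \<omega> t $ i + (\<Sum>j\<in>UNIV. a $ i $ j * sin (\<theta> t $ j - \<theta> t $ i))))"

definition local_field :: "real ^ 'n ^ 'n \<Rightarrow> real ^ 'n \<Rightarrow> 'n \<Rightarrow> complex"
  where "local_field a \<Theta> i = (\<Sum>j\<in>UNIV. of_real (a $ i $ j) * exp (\<i> * of_real (\<Theta> $ j)))"

definition local_order_parameter :: "real ^ 'n ^ 'n \<Rightarrow> real ^ 'n \<Rightarrow> 'n \<Rightarrow> real"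
  where "local_order_parameter a \<Theta> i = norm (local_field a \<Theta> i)"

text \<open>The polar decomposition, with nonnegative radius, determines the local order parameter.\<close>

lemma local_order_parameter_iff:
  "local_order_parameter a \<Theta> i = R \<longleftrightarrow>
    R \<ge> 0 \<and> (\<exists>\<phi>::real. of_real R * exp (\<i> * of_real \<phi>) = local_field a \<Theta> i)"
proof
  assume R: "local_order_parameter a \<Theta> i = R"
  have "of_real R * exp (\<i> * of_real (Arg (local_field a \<Theta> i))) = local_field a \<Theta> i"
    unfolding R [symmetric] local_order_parameter_def
    using rcis_cmod_Arg [of "local_field a \<Theta> i"] by (simp add: rcis_def cis_conv_exp)
  then show "R \<ge> 0 \<and> (\<exists>\<phi>::real. of_real R * exp (\<i> * of_real \<phi>) = local_field a \<Theta> i)"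
    using R by (auto simp: local_order_parameter_def)
next
  assume "R \<ge> 0 \<and> (\<exists>\<phi>::real. of_real R * exp (\<i> * of_real \<phi>) = local_field a \<Theta> i)"
  then obtain \<phi> :: real
    where "R \<ge> 0" "local_field a \<Theta> i = of_real R * exp (\<i> * of_real \<phi>)"
    by metis
  then show "local_order_parameter a \<Theta> i = R"
    by (simp add: local_order_parameter_def norm_mult)
qed

text \<open>Where the field never vanishes, a continuous phase exists and is determined up to a constant
  multiple of \<open>2 * pi\<close>, so it is described by a predicate rather than a function.\<close>

definition local_average_phase ::
  "real ^ 'n ^ 'n \<Rightarrow> (real \<Rightarrow> real ^ 'n) \<Rightarrow> 'n \<Rightarrow> (real \<Rightarrow> real) \<Rightarrow> bool"
  where "local_average_phase a \<theta> i \<phi> \<longleftrightarrow>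
    continuous_on {0..} \<phi> \<and>
    (\<forall>t\<ge>0. of_real (local_order_parameter a (\<theta> t) i) * exp (\<i> * of_real (\<phi> t)) =
      local_field a (\<theta> t) i)"

lemma local_average_phase_exists:
  assumes cont: "continuous_on {0..} \<theta>"
    and pos: "\<And>t. t \<ge> 0 \<Longrightarrow> local_order_parameter a (\<theta> t) i > 0"
  shows "\<exists>\<phi>. local_average_phase a \<theta> i \<phi>"
proof -
  have 1: "continuous_on {0..} (\<lambda>t. local_field a (\<theta> t) i)"
    unfolding local_field_def by (intro continuous_intros cont)
  have 2: "local_field a (\<theta> t) i \<noteq> 0" if "t \<in> {0..}" for t
    using pos [of t] that by (auto simp: local_order_parameter_def)
  have 3: "contractible {0::real..}"
    by (simp add: convex_imp_contractible)
  obtain g where g: "continuous_on {0..} g"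
    "\<And>t. t \<in> {0..} \<Longrightarrow> local_field a (\<theta> t) i = exp (g t)"
    using continuous_logarithm_on_contractible [OF 1 3 2] by blast
  have "of_real (local_order_parameter a (\<theta> t) i) * exp (\<i> * of_real (Im (g t))) =
      local_field a (\<theta> t) i" if "t \<ge> 0" for t
    using g(2) [of t] that
    by (simp add: local_order_parameter_def norm_exp_eq_Re exp_of_real [symmetric]
        exp_add [symmetric] complex_eq [symmetric] del: exp_of_real)
  then have "local_average_phase a \<theta> i (\<lambda>t. Im (g t))"
    unfolding local_average_phase_def using g(1) by (simp add: continuous_on_Im)
  then show ?thesis by blast
qed

definition phase_locked :: "(real \<Rightarrow> real ^ 'n) \<Rightarrow> bool"
  where "phase_locked \<theta> \<longleftrightarrow>
    (\<forall>i j. \<forall>t\<ge>0. \<bar>\<theta> t $ i - \<theta> t $ j\<bar> = \<bar>\<theta> 0 $ i - \<theta> 0 $ j\<bar>)"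

end

theory Submission
  imports Defs
begin

text \<open>
  Write \<open>P\<close> for the double sum of the \<open>a\<^sub>i\<^sub>j cos (\<theta>\<^sub>i - \<theta>\<^sub>j)\<close> (the coherence) and \<open>S\<^sub>i\<close> for the coupling
  force on oscillator \<open>i\<close>.  By symmetry of the coupling the system is a damped mechanical system
  with potential proportional to \<open>- P\<close>: the energy \<open>H = \<Sum> m\<^sub>i \<omega>\<^sub>i\<^sup>2 - P\<close> satisfies
  \<open>H' = - 2 \<Sum> \<gamma>\<^sub>i \<omega>\<^sub>i\<^sup>2\<close>.

  The energy decreases and is bounded below, so it converges.  A Barbalat-type argument, namely
  that a convergent function with bounded second derivative has a derivative tending to zero
  (\<open>derivative_tendsto_zero\<close>), gives \<open>\<omega> \<longlongrightarrow> 0\<close>, hence synchronization.  The same argument applied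
  to \<open>\<omega>\<close> itself gives \<open>\<omega>' \<longlongrightarrow> 0\<close>, and then the equation of motion gives \<open>S\<^sub>i \<longlongrightarrow> 0\<close>.

  The local field \<open>z\<^sub>i\<close> links this to the order parameters.  Turned by the phase \<open>\<theta>\<^sub>i\<close>, its imaginary
  part is \<open>S\<^sub>i\<close> and the real parts sum to \<open>P\<close>.  Hence \<open>S\<^sub>i\<close> is up to sign
  \<open>R\<^sub>i sin (\<theta>\<^sub>i - \<phi>\<^sub>i)\<close>, so once \<open>R\<^sub>i\<close> stays away from zero the sine tends to zero, and by
  continuity \<open>\<theta>\<^sub>i - \<phi>\<^sub>i\<close> has to settle at one multiple of \<open>\<pi>\<close>.

  For the lower bound on \<open>R\<^sub>i\<close>, compare with all-to-all coupling of strength \<open>abar\<close>: with \<open>Z\<close> the sum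
  of the unit vectors of the phases, each \<open>z\<^sub>i\<close> is within \<open>\<delta>\<close> of \<open>abar Z\<close>, and \<open>P\<close> is within \<open>\<delta> N\<close> of
  \<open>abar \<bar>Z\<bar>\<^sup>2\<close>.  So \<open>P \<ge> \<delta> N + \<delta>\<^sup>2 / abar + c\<close> forces \<open>R\<^sub>i \<ge> sqrt (\<delta>\<^sup>2 + abar c) - \<delta>\<close>, which is
  positive for \<open>c > 0\<close>.  Since \<open>P \<ge> - H\<close> and \<open>H\<close> decreases, the initial inequality provides
  \<open>c = 2 \<delta> N\<close> if \<open>\<delta> > 0\<close>.  If \<open>\<delta> = 0\<close>, a positive initial coherence stays away from zero: if the
  system starts at rest, then already \<open>H < 0\<close> at time zero; otherwise it dissipates energy at once,
  so that \<open>H < 0\<close> from any positive time on (\<open>coherence_bounded_below\<close>).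

  If the initial coherence vanishes, the initial inequality leaves room only for \<open>\<delta> = 0\<close> and
  \<open>\<omega> = 0\<close>.  Then \<open>Z = 0\<close>, so no force acts on the system, which starts at rest and therefore stays
  at the equilibrium by uniqueness.
\<close>

section \<open>Facts from real analysis\<close>

text \<open>Since \<open>g\<close> varies by at most \<open>K s\<close> over a time step \<open>s\<close>, the value \<open>g t\<close> differs by at most \<open>K s\<close>
  from the difference quotient of \<open>f\<close> with step \<open>s\<close>, and for fixed \<open>s\<close> this quotient tends to
  zero.\<close>

lemma derivative_tendsto_zero:
  fixes f g h :: "real \<Rightarrow> real"
  assumes f: "\<And>t. t > 0 \<Longrightarrow> (f has_real_derivative g t) (at t)"
    and g: "\<And>t. t > 0 \<Longrightarrow> (g has_real_derivative h t) (at t)"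
    and h: "\<And>t. t > 0 \<Longrightarrow> \<bar>h t\<bar> \<le> K"
    and lim: "(f \<longlongrightarrow> L) at_top"
  shows "(g \<longlongrightarrow> 0) at_top"
proof (rule tendstoI)
  fix e :: real
  assume e: "e > 0"
  have K: "K \<ge> 0"
    using h [of 1] by linarith
  \<comment> \<open>With \<open>K + 1\<close> in place of \<open>K\<close> the step is well defined even for \<open>K = 0\<close>.\<close>
  define s where "s = e / (2 * (K + 1))"
  have s: "s > 0" "K * s \<le> e / 2"
    using e K by (auto simp: s_def field_simps)
  have bound: "\<bar>g t\<bar> \<le> \<bar>f (t + s) - f t\<bar> / s + K * s" if t: "t > 0" for t
  proof -
    obtain z where z: "t < z" "z < t + s" "f (t + s) - f t = (t + s - t) * g z"
      using MVT2 [of t "t + s" f g] f t s(1) by force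
    obtain y where y: "t < y" "y < z" "g z - g t = (z - t) * h y"
      using MVT2 [of t z g h] g t z(1) by force
    have "\<bar>g z - g t\<bar> \<le> s * K"
      unfolding y(3) abs_mult using z h [of y] t y by (intro mult_mono) auto
    moreover have "g z = (f (t + s) - f t) / s"
      using z(3) s(1) by simp
    ultimately have "\<bar>g t\<bar> \<le> \<bar>(f (t + s) - f t) / s\<bar> + K * s"
      unfolding mult.commute [of s K] by linarith
    then show ?thesis
      using s(1) by simp
  qed
  have "filterlim (\<lambda>t. t + s) at_top at_top"
    by (rule filterlim_at_top_mono [OF filterlim_ident]) (use s(1) in auto)
  then have "((\<lambda>t. f (t + s)) \<longlongrightarrow> L) at_top"
    by (rule filterlim_compose [OF lim])
  from tendsto_diff [OF this lim] have "((\<lambda>t. f (t + s) - f t) \<longlongrightarrow> 0) at_top"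
    by simp
  from tendstoD [OF this, of "s * e / 2"] have
    "\<forall>\<^sub>F t in at_top. \<bar>f (t + s) - f t\<bar> < s * e / 2"
    using s(1) e by simp
  then show "\<forall>\<^sub>F t in at_top. dist (g t) 0 < e"
    using eventually_gt_at_top [of 0]
  proof eventually_elim
    case (elim t)
    have "\<bar>f (t + s) - f t\<bar> / s < e / 2"
      using elim(1) s(1) by (simp add: field_simps)
    then have "\<bar>g t\<bar> < e"
      using bound [OF elim(2)] s(2) by linarith
    then show ?case
      by simp
  qed
qed

text \<open>From the time on where \<open>\<bar>sin u\<bar> < 1\<close>, continuity forbids \<open>u\<close> to cross an odd multiple of
  \<open>\<pi> / 2\<close>, so \<open>u\<close> is trapped near one multiple of \<open>\<pi>\<close>, where the sine can be inverted.\<close>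

lemma continuous_sin_tendsto_zero_imp_tendsto_multiple_pi:
  fixes u :: "real \<Rightarrow> real"
  assumes cont: "continuous_on {c..} u"
    and lim: "((\<lambda>t. sin (u t)) \<longlongrightarrow> 0) at_top"
  shows "\<exists>k::int. (u \<longlongrightarrow> of_int k * pi) at_top"
proof -
  from tendstoD [OF lim, of 1] obtain T0 where "\<And>t. t \<ge> T0 \<Longrightarrow> \<bar>sin (u t)\<bar> < 1"
    by (auto simp: eventually_at_top_linorder)
  then obtain T where T: "T \<ge> c" "\<And>t. t \<ge> T \<Longrightarrow> \<bar>sin (u t)\<bar> < 1"
    by (metis max.cobounded1 max.cobounded2 order_trans)
  define k where "k = round (u T / pi)"
  define v where "v t = u t - of_int k * pi" for t
  have sin_v: "\<bar>sin (v t)\<bar> = \<bar>sin (u t)\<bar>" for t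
    by (simp add: v_def sin_diff abs_mult mult.commute [of "of_int k"])
  have v_cont: "continuous_on {T..t} v" for t
    unfolding v_def by (intro continuous_intros continuous_on_subset [OF cont]) (use T(1) in auto)
  have no_crossing: "\<bar>v t\<bar> \<noteq> pi / 2" if "t \<ge> T" for t
  proof
    assume "\<bar>v t\<bar> = pi / 2"
    then have "v t = pi / 2 \<or> v t = - (pi / 2)"
      by linarith
    then have "sin (v t) = 1 \<or> sin (v t) = - 1"
      by (elim disjE) (simp_all only: sin_minus sin_pi_half simp_thms)
    then have "\<bar>sin (v t)\<bar> = 1"
      by linarith
    then show False
      using T(2) [OF that] sin_v [of t] by simp
  qed
  have vT: "\<bar>v T\<bar> \<le> pi / 2"
  proof -
    have "\<bar>u T / pi - of_int k\<bar> * pi \<le> 1 / 2 * pi"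
      using of_int_round_abs_le [of "u T / pi"]
      by (intro mult_right_mono) (auto simp: k_def abs_minus_commute)
    moreover have "\<bar>u T / pi - of_int k\<bar> * pi = \<bar>v T\<bar>"
      unfolding v_def by (subst abs_of_pos [OF pi_gt_zero, symmetric], subst abs_mult [symmetric])
        (simp add: algebra_simps)
    ultimately show ?thesis
      by simp
  qed
  have v_small: "\<bar>v t\<bar> < pi / 2" if t: "t \<ge> T" for t
  proof (rule ccontr)
    assume "\<not> ?thesis"
    then have "\<exists>s. T \<le> s \<and> s \<le> t \<and> \<bar>v s\<bar> = pi / 2"
      using vT t v_cont by (intro IVT' [of "\<lambda>s. \<bar>v s\<bar>"] continuous_intros) auto
    then show False
      using no_crossing by blast
  qed
  have "((\<lambda>t. sin (v t)) \<longlongrightarrow> 0) at_top"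
    using lim by (subst tendsto_rabs_zero_iff [symmetric]) (simp add: sin_v tendsto_rabs_zero_iff)
  then have "((\<lambda>t. arcsin (sin (v t))) \<longlongrightarrow> arcsin 0) at_top"
    by (intro isCont_tendsto_compose [OF isCont_arcsin]) auto
  moreover have "\<forall>\<^sub>F t in at_top. arcsin (sin (v t)) = v t"
    using eventually_ge_at_top [of T]
  proof eventually_elim
    case (elim t)
    then show ?case
      using v_small [OF elim] by (intro arcsin_sin) linarith+
  qed
  ultimately have "(v \<longlongrightarrow> 0) at_top"
    using tendsto_cong by fastforce
  then have "((\<lambda>t. v t + of_int k * pi) \<longlongrightarrow> 0 + of_int k * pi) at_top"
    by (intro tendsto_intros)
  then show ?thesis
    by (auto simp: v_def)
qed

text \<open>The weighted function \<open>u t * exp (- C * t)\<close> is nonincreasing.\<close>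

lemma gronwall_zero:
  fixes u u' :: "real \<Rightarrow> real"
  assumes cont: "continuous_on {0..} u"
    and u: "\<And>t. t > 0 \<Longrightarrow> (u has_real_derivative u' t) (at t)"
    and le: "\<And>t. t > 0 \<Longrightarrow> u' t \<le> C * u t"
    and nonneg: "\<And>t. t \<ge> 0 \<Longrightarrow> u t \<ge> 0"
    and "u 0 = 0" "t \<ge> 0"
  shows "u t = 0"
proof -
  have "u t * exp (- C * t) \<le> u 0 * exp (- C * 0)"
  proof (rule DERIV_nonpos_imp_decreasing_open [of 0 t "\<lambda>t. u t * exp (- C * t)"])
    show "0 \<le> t"
      by fact
    show "continuous_on {0..t} (\<lambda>t. u t * exp (- C * t))"
      by (intro continuous_intros continuous_on_subset [OF cont]) auto
    fix s :: real
    assume s: "0 < s" "s < t"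
    have "((\<lambda>t. exp (- C * t)) has_real_derivative - C * exp (- C * s)) (at s)"
      by (auto intro!: derivative_eq_intros)
    from DERIV_mult [OF u [OF s(1)] this]
    have "((\<lambda>t. u t * exp (- C * t)) has_real_derivative (u' s - C * u s) * exp (- C * s)) (at s)"
      by (simp add: algebra_simps)
    moreover have "(u' s - C * u s) * exp (- C * s) \<le> 0"
      using le [OF s(1)] by (simp add: mult_le_0_iff)
    ultimately show "\<exists>y. ((\<lambda>t. u t * exp (- C * t)) has_real_derivative y) (at s) \<and> y \<le> 0"
      by blast
  qed
  then show ?thesis
    using nonneg [OF \<open>t \<ge> 0\<close>] \<open>u 0 = 0\<close> by (simp add: mult_le_0_iff)
qed

lemma DERIV_square:
  fixes f :: "real \<Rightarrow> real"
  assumes "(f has_real_derivative D) (at t)"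
  shows "((\<lambda>t. (f t)\<^sup>2) has_real_derivative 2 * f t * D) (at t)"
  using DERIV_power [OF assms, of 2] by (simp add: mult_ac)

section \<open>Coherence, forces and local fields\<close>

definition coherence :: "real ^ 'n ^ 'n \<Rightarrow> real ^ 'n \<Rightarrow> real"
  where "coherence a x = (\<Sum>i\<in>UNIV. \<Sum>j\<in>UNIV. a $ i $ j * cos (x $ i - x $ j))"

definition coupling_force :: "real ^ 'n ^ 'n \<Rightarrow> real ^ 'n \<Rightarrow> 'n \<Rightarrow> real"
  where "coupling_force a x i = (\<Sum>j\<in>UNIV. a $ i $ j * sin (x $ j - x $ i))"

definition mean_field :: "real ^ 'n \<Rightarrow> complex"
  where "mean_field x = (\<Sum>j\<in>UNIV. exp (\<i> * of_real (x $ j)))"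

text \<open>Seen from oscillator \<open>i\<close>, the component of the local field along its own direction contributes
  to the coherence, and the perpendicular component is the force acting on it.\<close>

lemma rotated_local_field:
  "exp (- (\<i> * of_real (x $ i))) * local_field a x i =
    Complex (\<Sum>j\<in>UNIV. a $ i $ j * cos (x $ i - x $ j)) (coupling_force a x i)"
proof -
  have "exp (- (\<i> * of_real (x $ i))) * local_field a x i =
      (\<Sum>j\<in>UNIV. of_real (a $ i $ j) * cis (x $ j - x $ i))"
    unfolding local_field_def sum_distrib_left
    by (intro sum.cong) (auto simp: cis_conv_exp exp_diff exp_minus field_simps)
  also have "\<dots> = Complex (\<Sum>j\<in>UNIV. a $ i $ j * cos (x $ i - x $ j)) (coupling_force a x i)"
    by (simp add: complex_eq_iff coupling_force_def cos_diff mult_ac)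
  finally show ?thesis .
qed

lemma coherence_eq_sum_Re:
  "coherence a x = (\<Sum>i\<in>UNIV. Re (exp (- (\<i> * of_real (x $ i))) * local_field a x i))"
  unfolding rotated_local_field by (simp add: coherence_def)

lemma local_field_near_mean_field:
  assumes "(\<Sum>j\<in>UNIV. \<bar>a $ i $ j - abar\<bar>) \<le> \<delta>"
  shows "norm (local_field a x i - of_real abar * mean_field x) \<le> \<delta>"
proof -
  have "local_field a x i - of_real abar * mean_field x =
      (\<Sum>j\<in>UNIV. of_real (a $ i $ j - abar) * exp (\<i> * of_real (x $ j)))"
    by (simp add: local_field_def mean_field_def sum_distrib_left sum_subtractf [symmetric]
        algebra_simps)
  also have "norm \<dots> \<le> (\<Sum>j\<in>UNIV. \<bar>a $ i $ j - abar\<bar>)"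
    by (intro order_trans [OF norm_sum] sum_mono) (simp add: norm_mult flip: of_real_diff)
  finally show ?thesis
    using assms by linarith
qed

text \<open>Up to an error \<open>\<delta>\<close> for each oscillator, the local fields may be replaced by \<open>abar Z\<close>, where
  \<open>Z\<close> is the mean field; the sum of the projections of \<open>abar Z\<close> onto all phase directions is
  \<open>abar \<bar>Z\<bar>\<^sup>2\<close>.\<close>

lemma coherence_near_mean_field:
  fixes a :: "real ^ 'n ^ 'n"
  assumes "\<And>i. (\<Sum>j\<in>UNIV. \<bar>a $ i $ j - abar\<bar>) \<le> \<delta>"
  shows "\<bar>coherence a x - abar * (norm (mean_field x))\<^sup>2\<bar> \<le> \<delta> * real CARD('n)"
proof -
  have "complex_of_real (abar * (norm (mean_field x))\<^sup>2) =
      of_real abar * (cnj (mean_field x) * mean_field x)"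
    by (simp only: of_real_mult complex_norm_square mult.commute [of "cnj (mean_field x)"])
  also have "\<dots> = (\<Sum>i\<in>UNIV. exp (- (\<i> * of_real (x $ i))) * (of_real abar * mean_field x))"
    by (simp add: mean_field_def [of x] exp_cnj sum_distrib_left sum_distrib_right mult_ac)
  finally have "abar * (norm (mean_field x))\<^sup>2 =
      (\<Sum>i\<in>UNIV. Re (exp (- (\<i> * of_real (x $ i))) * (of_real abar * mean_field x)))"
    by (metis Re_complex_of_real Re_sum)
  then have "coherence a x - abar * (norm (mean_field x))\<^sup>2 =
      (\<Sum>i\<in>UNIV. Re (exp (- (\<i> * of_real (x $ i))) *
        (local_field a x i - of_real abar * mean_field x)))"
    by (simp only: coherence_eq_sum_Re sum_subtractf [symmetric] right_diff_distrib minus_complex.sel)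
  also have "\<bar>\<dots>\<bar> \<le> (\<Sum>i\<in>(UNIV :: 'n set). \<delta>)"
  proof (intro order_trans [OF sum_abs] sum_mono order_trans [OF abs_Re_le_cmod])
    fix i :: 'n
    show "norm (exp (- (\<i> * of_real (x $ i))) *
        (local_field a x i - of_real abar * mean_field x)) \<le> \<delta>"
      using local_field_near_mean_field [OF assms] by (simp add: norm_mult)
  qed
  finally show ?thesis
    by (simp add: mult.commute)
qed

text \<open>A coherence bound turns into a bound on the mean field \<open>Z\<close> at the cost of \<open>\<delta> N\<close>, and the bound on
  \<open>abar \<bar>Z\<bar>\<close> into one on the order parameter at the cost of \<open>\<delta>\<close>.  The term \<open>\<delta>\<^sup>2 / abar\<close> is what pays
  for the second loss.\<close>

lemma local_order_parameter_lower_bound: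
  fixes a :: "real ^ 'n ^ 'n"
  assumes "abar > 0" "\<delta> \<ge> 0" "c \<ge> 0"
    and a_near: "\<And>i. (\<Sum>j\<in>UNIV. \<bar>a $ i $ j - abar\<bar>) \<le> \<delta>"
    and coh: "coherence a x \<ge> \<delta> * real CARD('n) + \<delta>\<^sup>2 / abar + c"
  shows "local_order_parameter a x i \<ge> sqrt (\<delta>\<^sup>2 + abar * c) - \<delta>"
proof -
  have "\<delta>\<^sup>2 / abar + c \<le> abar * (norm (mean_field x))\<^sup>2"
    using coherence_near_mean_field [OF a_near, of x] coh by linarith
  then have "abar * (\<delta>\<^sup>2 / abar + c) \<le> abar * (abar * (norm (mean_field x))\<^sup>2)"
    using \<open>abar > 0\<close> by (intro mult_left_mono) auto
  also have "\<dots> = (abar * norm (mean_field x))\<^sup>2"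
    by (simp add: power2_eq_square)
  also have "abar * (\<delta>\<^sup>2 / abar + c) = \<delta>\<^sup>2 + abar * c"
    using \<open>abar > 0\<close> by (simp add: distrib_left)
  finally have "sqrt (\<delta>\<^sup>2 + abar * c) \<le> abar * norm (mean_field x)"
    using \<open>abar > 0\<close> by (intro real_le_lsqrt) auto
  moreover have "norm (of_real abar * mean_field x) - norm (local_field a x i) \<le> \<delta>"
    using local_field_near_mean_field [where x = x and i = i, OF a_near] norm_triangle_ineq2
    by (metis norm_minus_commute order_trans)
  ultimately show ?thesis
    using \<open>abar > 0\<close> by (simp add: local_order_parameter_def norm_mult)
qed

lemma local_average_phase_sin:
  assumes "local_average_phase a \<theta> i \<phi>" "t \<ge> 0"
  shows "coupling_force a (\<theta> t) i = - local_order_parameter a (\<theta> t) i * sin (\<theta> t $ i - \<phi> t)"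
proof -
  have "exp (- (\<i> * of_real (\<theta> t $ i))) * local_field a (\<theta> t) i =
      of_real (local_order_parameter a (\<theta> t) i) * cis (\<phi> t - \<theta> t $ i)"
    using assms unfolding local_average_phase_def
    by (auto simp: cis_conv_exp exp_diff exp_minus field_simps)
  then have "coupling_force a (\<theta> t) i = local_order_parameter a (\<theta> t) i * sin (\<phi> t - \<theta> t $ i)"
    unfolding rotated_local_field by (simp add: complex_eq_iff)
  then show ?thesis
    by (simp add: sin_diff algebra_simps)
qed

text \<open>The left-hand side is the derivative of the coherence along phases moving with velocity \<open>w\<close>.
  By symmetry of the coupling both oscillators of a pair contribute equally, whence the factor 2:
  the forces are half the gradient of the coherence.\<close>

lemma work_of_coupling_forces:
  assumes sym: "\<And>i j. a $ i $ j = a $ j $ i"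
  shows "(\<Sum>i\<in>UNIV. \<Sum>j\<in>UNIV. a $ i $ j * (- sin (x $ i - x $ j) * (w $ i - w $ j))) =
    2 * (\<Sum>i\<in>UNIV. w $ i * coupling_force a x i)"
proof -
  have "(\<Sum>i\<in>UNIV. \<Sum>j\<in>UNIV. a $ i $ j * (- sin (x $ i - x $ j) * (w $ i - w $ j))) =
      (\<Sum>i\<in>UNIV. \<Sum>j\<in>UNIV. a $ i $ j * sin (x $ j - x $ i) * w $ i) +
      (\<Sum>i\<in>UNIV. \<Sum>j\<in>UNIV. a $ i $ j * sin (x $ i - x $ j) * w $ j)"
    by (simp add: sum.distrib [symmetric] sin_diff algebra_simps)
  also have "(\<Sum>i\<in>UNIV. \<Sum>j\<in>UNIV. a $ i $ j * sin (x $ i - x $ j) * w $ j) =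
      (\<Sum>i\<in>UNIV. \<Sum>j\<in>UNIV. a $ i $ j * sin (x $ j - x $ i) * w $ i)"
    by (subst sum.swap) (simp add: sym)
  finally show ?thesis
    by (simp add: coupling_force_def sum_distrib_left mult_ac)
qed

lemma coherence_le: "coherence a x \<le> (\<Sum>i\<in>UNIV. \<Sum>j\<in>UNIV. \<bar>a $ i $ j\<bar>)"
  unfolding coherence_def
proof (intro sum_mono)
  fix i j
  have "\<bar>a $ i $ j * cos (x $ i - x $ j)\<bar> \<le> \<bar>a $ i $ j\<bar> * 1"
    unfolding abs_mult by (intro mult_left_mono) auto
  then show "a $ i $ j * cos (x $ i - x $ j) \<le> \<bar>a $ i $ j\<bar>"
    by linarith
qed

lemma abs_coupling_force_le: "\<bar>coupling_force a x i\<bar> \<le> (\<Sum>j\<in>UNIV. \<bar>a $ i $ j\<bar>)"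
  unfolding coupling_force_def
proof (intro order_trans [OF sum_abs] sum_mono)
  fix j
  show "\<bar>a $ i $ j * sin (x $ j - x $ i)\<bar> \<le> \<bar>a $ i $ j\<bar>"
    by (simp add: abs_mult mult_left_le)
qed

lemma abs_sin_diff_le: "\<bar>sin x - sin y\<bar> \<le> \<bar>x - y\<bar>" for x y :: real
proof -
  have "\<bar>sin x - sin y\<bar> = 2 * (\<bar>sin ((x - y) / 2)\<bar> * \<bar>cos ((x + y) / 2)\<bar>)"
    by (simp add: sin_diff_sin abs_mult)
  also have "\<dots> \<le> 2 * (\<bar>(x - y) / 2\<bar> * 1)"
    by (intro mult_left_mono mult_mono abs_sin_x_le_abs_x) auto
  finally show ?thesis
    by simp
qed

lemma abs_coupling_force_diff_le:
  "\<bar>coupling_force a x i - coupling_force a y i\<bar> \<le>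
    (\<Sum>j\<in>UNIV. \<bar>a $ i $ j\<bar> * (\<bar>x $ j - y $ j\<bar> + \<bar>x $ i - y $ i\<bar>))"
  unfolding coupling_force_def sum_subtractf [symmetric] right_diff_distrib [symmetric]
proof (intro order_trans [OF sum_abs] sum_mono)
  fix j
  have "\<bar>sin (x $ j - x $ i) - sin (y $ j - y $ i)\<bar> \<le> \<bar>x $ j - y $ j\<bar> + \<bar>x $ i - y $ i\<bar>"
    using abs_sin_diff_le [of "x $ j - x $ i" "y $ j - y $ i"] by linarith
  then show "\<bar>a $ i $ j * (sin (x $ j - x $ i) - sin (y $ j - y $ i))\<bar> \<le>
      \<bar>a $ i $ j\<bar> * (\<bar>x $ j - y $ j\<bar> + \<bar>x $ i - y $ i\<bar>)"
    unfolding abs_mult by (rule mult_left_mono) simp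
qed

section \<open>Energy dissipation\<close>

text \<open>The initial data are recorded as the values of the trajectory at time zero.\<close>

locale inertial_kuramoto =
  fixes m \<gamma> :: "real ^ 'n" and a :: "real ^ 'n ^ 'n" and \<theta> \<omega> :: "real \<Rightarrow> real ^ 'n"
  assumes a_sym: "a $ i $ j = a $ j $ i"
    and m_pos: "m $ i > 0"
    and gamma_pos: "\<gamma> $ i > 0"
    and solution: "inertial_kuramoto_solution m \<gamma> a (\<theta> 0) (\<omega> 0) \<theta> \<omega>"
begin

definition acceleration :: "real \<Rightarrow> 'n \<Rightarrow> real"
  where "acceleration t i = (- \<gamma> $ i * \<omega> t $ i + coupling_force a (\<theta> t) i) / m $ i"

text \<open>Twice the mechanical energy, with potential \<open>- coherence a / 2\<close>.\<close>

definition energy :: "real \<Rightarrow> real"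
  where "energy t = (\<Sum>i\<in>UNIV. m $ i * (\<omega> t $ i)\<^sup>2) - coherence a (\<theta> t)"

lemma theta_deriv: "((\<lambda>t. \<theta> t $ i) has_real_derivative \<omega> t $ i) (at t)" if "t > 0"
proof -
  have "(\<theta> has_vector_derivative \<omega> t) (at t within {0..})"
    using solution that by (auto simp: inertial_kuramoto_solution_def)
  moreover have "at t within {0..} = at t"
    using that by (intro at_within_interior) simp
  ultimately have "(\<theta> has_vector_derivative \<omega> t) (at t)"
    by simp
  from bounded_linear.has_vector_derivative [OF bounded_linear_vec_nth this] show ?thesis
    by (simp add: has_real_derivative_iff_has_vector_derivative)
qed

lemma omega_deriv: "((\<lambda>t. \<omega> t $ i) has_real_derivative acceleration t i) (at t)" if "t > 0"
proof -
  have "\<forall>t>0. \<exists>w. (\<omega> has_vector_derivative w) (at t) \<and>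
      (\<forall>i. m $ i * w $ i = - \<gamma> $ i * \<omega> t $ i + coupling_force a (\<theta> t) i)"
    using solution unfolding inertial_kuramoto_solution_def coupling_force_def by (elim conjE)
  then obtain w where w: "(\<omega> has_vector_derivative w) (at t)"
    "m $ i * w $ i = - \<gamma> $ i * \<omega> t $ i + coupling_force a (\<theta> t) i"
    using \<open>t > 0\<close> by blast
  have "w $ i = acceleration t i"
    using w(2) m_pos [of i] by (simp add: acceleration_def field_simps)
  with bounded_linear.has_vector_derivative [OF bounded_linear_vec_nth w(1), of i] show ?thesis
    by (simp add: has_real_derivative_iff_has_vector_derivative)
qed

lemma omega_continuous: "continuous_on {0..} \<omega>"
  using solution by (simp add: inertial_kuramoto_solution_def)

lemma theta_continuous: "continuous_on {0..} \<theta>"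
  unfolding continuous_on_eq_continuous_within
proof
  fix t :: real
  assume "t \<in> {0..}"
  then have "(\<theta> has_vector_derivative \<omega> t) (at t within {0..})"
    using solution by (simp add: inertial_kuramoto_solution_def)
  then show "continuous (at t within {0..}) \<theta>"
    by (rule has_vector_derivative_continuous)
qed

lemma coherence_continuous: "continuous_on {0..} (\<lambda>t. coherence a (\<theta> t))"
  unfolding coherence_def by (intro continuous_intros theta_continuous)

lemma energy_continuous: "continuous_on {0..} energy"
  unfolding energy_def by (intro continuous_intros coherence_continuous omega_continuous)

lemma coupling_force_deriv:
  assumes "t > 0"
  shows "((\<lambda>t. coupling_force a (\<theta> t) i) has_real_derivative
    (\<Sum>j\<in>UNIV. a $ i $ j * (cos (\<theta> t $ j - \<theta> t $ i) * (\<omega> t $ j - \<omega> t $ i)))) (at t)"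
  unfolding coupling_force_def
  by (intro DERIV_sum DERIV_cmult DERIV_fun_sin DERIV_diff theta_deriv [OF assms])

lemma energy_deriv:
  assumes "t > 0"
  shows "(energy has_real_derivative (- 2 * (\<Sum>i\<in>UNIV. \<gamma> $ i * (\<omega> t $ i)\<^sup>2))) (at t)"
proof -
  have coh: "((\<lambda>t. coherence a (\<theta> t)) has_real_derivative
      2 * (\<Sum>i\<in>UNIV. \<omega> t $ i * coupling_force a (\<theta> t) i)) (at t)"
    unfolding coherence_def
      work_of_coupling_forces [OF a_sym, of "\<theta> t" "\<omega> t", symmetric]
    by (intro DERIV_sum DERIV_cmult DERIV_fun_cos DERIV_diff theta_deriv [OF assms])
  have "(\<Sum>i\<in>UNIV. m $ i * (2 * (\<omega> t $ i) * acceleration t i)) =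
      (\<Sum>i\<in>UNIV. 2 * (\<omega> t $ i * coupling_force a (\<theta> t) i) - 2 * (\<gamma> $ i * (\<omega> t $ i)\<^sup>2))"
    using m_pos by (intro sum.cong)
      (auto simp: acceleration_def field_simps power2_eq_square less_imp_neq [THEN not_sym])
  then have power: "(\<Sum>i\<in>UNIV. m $ i * (2 * (\<omega> t $ i) * acceleration t i)) =
      2 * (\<Sum>i\<in>UNIV. \<omega> t $ i * coupling_force a (\<theta> t) i)
      - 2 * (\<Sum>i\<in>UNIV. \<gamma> $ i * (\<omega> t $ i)\<^sup>2)"
    by (simp add: sum_subtractf sum_distrib_left)
  have kinetic: "((\<lambda>t. \<Sum>i\<in>UNIV. m $ i * (\<omega> t $ i)\<^sup>2) has_real_derivative
      (\<Sum>i\<in>UNIV. m $ i * (2 * (\<omega> t $ i) * acceleration t i))) (at t)"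
    by (intro DERIV_sum DERIV_cmult DERIV_square omega_deriv [OF assms])
  show ?thesis
    unfolding energy_def
    using DERIV_diff [OF kinetic coh] unfolding power by simp
qed

lemma energy_antimono:
  assumes "0 \<le> s" "s \<le> t"
  shows "energy t \<le> energy s"
proof (rule DERIV_nonpos_imp_decreasing_open [of s t energy])
  show "s \<le> t"
    by fact
  show "continuous_on {s..t} energy"
    by (rule continuous_on_subset [OF energy_continuous]) (use assms in auto)
  fix r
  assume "s < r" "r < t"
  then have "(energy has_real_derivative (- 2 * (\<Sum>i\<in>UNIV. \<gamma> $ i * (\<omega> r $ i)\<^sup>2))) (at r)"
    using assms by (intro energy_deriv) simp
  moreover have "- 2 * (\<Sum>i\<in>UNIV. \<gamma> $ i * (\<omega> r $ i)\<^sup>2) \<le> 0"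
    using gamma_pos by (simp add: sum_nonneg less_imp_le)
  ultimately show "\<exists>y. (energy has_real_derivative y) (at r) \<and> y \<le> 0"
    by blast
qed

lemma kinetic_nonneg: "(\<Sum>i\<in>UNIV. m $ i * (\<omega> t $ i)\<^sup>2) \<ge> 0"
  using m_pos by (simp add: sum_nonneg less_imp_le)

text \<open>If no energy were lost up to time \<open>t\<close>, the dissipation rate and hence the velocity would vanish
  on the open interval from \<open>0\<close> to \<open>t\<close>, and by continuity also at time zero.\<close>

lemma energy_strict_decrease:
  assumes "\<omega> 0 \<noteq> 0" "t > 0"
  shows "energy t < energy 0"
proof (rule ccontr)
  assume "\<not> ?thesis"
  then have const: "energy s = energy 0" if "0 \<le> s" "s \<le> t" for s
    using energy_antimono [of 0 s] energy_antimono [of s t] that assms by linarith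
  have rest: "\<omega> s = 0" if s: "0 < s" "s < t" for s
  proof -
    have "\<forall>\<^sub>F r in nhds s. r \<in> {0<..<t}"
      using s by (intro eventually_nhds_in_open) simp_all
    then have "\<forall>\<^sub>F r in nhds s. energy r = energy 0"
      by eventually_elim (rule const, simp_all)
    then have "(energy has_real_derivative 0) (at s)"
      by (rule iffD2 [OF DERIV_cong_ev [OF refl _ refl] DERIV_const])
    from DERIV_unique [OF energy_deriv [OF s(1)] this]
    have "(\<Sum>i\<in>UNIV. \<gamma> $ i * (\<omega> s $ i)\<^sup>2) = 0"
      by simp
    moreover have nonneg: "0 \<le> \<gamma> $ i * (\<omega> s $ i)\<^sup>2" for i
      using gamma_pos [of i] by simp
    ultimately have "\<gamma> $ i * (\<omega> s $ i)\<^sup>2 = 0" for i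
      by (simp only: sum_nonneg_eq_0_iff [OF finite nonneg] ball_UNIV)
    moreover have "\<gamma> $ i \<noteq> 0" for i
      using gamma_pos [of i] by simp
    ultimately show ?thesis
      by (simp add: vec_eq_iff)
  qed
  have "(\<omega> \<longlongrightarrow> \<omega> 0) (at 0 within {0..})"
    using omega_continuous by (simp add: continuous_on_def)
  then have "(\<omega> \<longlongrightarrow> \<omega> 0) (at_right 0)"
    by (rule tendsto_within_subset) auto
  moreover have "\<forall>\<^sub>F s in at_right 0. \<omega> s = 0"
    using eventually_at_right_real [OF \<open>t > 0\<close>] by eventually_elim (use rest in simp)
  ultimately have "((\<lambda>_. 0) \<longlongrightarrow> \<omega> 0) (at_right (0::real))"
    by (rule Lim_transform_eventually)
  then have "\<omega> 0 = 0"
    by (intro tendsto_unique [OF _ _ tendsto_const]) simp_all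
  then show False
    using assms by simp
qed

text \<open>The coherence dominates minus the energy, which never decreases.  For motion that starts at rest
  the initial value is already positive.  Otherwise the energy may start at zero, but it is negative
  at all later times: this bounds the coherence after time 1, and on the compact interval from 0 to
  1 the coherence is positive and attains its minimum.\<close>

lemma coherence_bounded_below:
  assumes "energy 0 \<le> 0" "coherence a (\<theta> 0) > 0"
  shows "\<exists>c>0. \<forall>t\<ge>0. coherence a (\<theta> t) \<ge> c"
proof -
  have ge: "coherence a (\<theta> t) \<ge> - energy t" for t
    using kinetic_nonneg [of t] by (simp add: energy_def)
  show ?thesis
  proof (cases "\<omega> 0 = 0")
    case True
    then have "energy 0 = - coherence a (\<theta> 0)"
      by (simp add: energy_def)
    then have "coherence a (\<theta> t) \<ge> coherence a (\<theta> 0)" if "t \<ge> 0" for t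
      using ge [of t] energy_antimono [of 0 t] that by linarith
    then show ?thesis
      using assms by blast
  next
    case False
    have neg: "energy t < 0" if "t > 0" for t
      using energy_strict_decrease [OF False that] assms by linarith
    have pos: "coherence a (\<theta> t) > 0" if "t \<ge> 0" for t
      using that assms(2) neg [of t] ge [of t] by (cases "t = 0") auto
    have "continuous_on {0..1} (\<lambda>t. coherence a (\<theta> t))"
      by (rule continuous_on_subset [OF coherence_continuous]) auto
    from continuous_attains_inf [OF _ _ this] obtain s where
      s: "s \<in> {0..1}" "\<And>t. t \<in> {0..1} \<Longrightarrow> coherence a (\<theta> s) \<le> coherence a (\<theta> t)"
      by auto
    have "coherence a (\<theta> t) \<ge> min (coherence a (\<theta> s)) (- energy 1)" if "t \<ge> 0" for t
    proof (cases "t \<le> 1")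
      case True
      then show ?thesis
        using s(2) [of t] that by auto
    next
      case False
      then show ?thesis
        using ge [of t] energy_antimono [of 1 t] by linarith
    qed
    moreover have "min (coherence a (\<theta> s)) (- energy 1) > 0"
      using pos [of s] s(1) neg [of 1] by simp
    ultimately show ?thesis
      by blast
  qed
qed

section \<open>Asymptotic behaviour\<close>

text \<open>The kinetic part is the energy plus the coherence; neither exceeds a fixed bound.\<close>

lemma omega_bounded: "\<exists>V. \<forall>t\<ge>0. \<bar>\<omega> t $ i\<bar> \<le> V"
proof -
  define B where "B = energy 0 + (\<Sum>i\<in>UNIV. \<Sum>j\<in>UNIV. \<bar>a $ i $ j\<bar>)"
  have "\<bar>\<omega> t $ i\<bar> \<le> sqrt (B / m $ i)" if "t \<ge> 0" for t
  proof -
    have "m $ i * (\<omega> t $ i)\<^sup>2 \<le> (\<Sum>i\<in>UNIV. m $ i * (\<omega> t $ i)\<^sup>2)"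
      using m_pos by (intro member_le_sum) (auto simp: less_imp_le)
    also have "\<dots> \<le> B"
      using energy_antimono [of 0 t] that coherence_le [of a "\<theta> t"] by (simp add: B_def energy_def)
    finally have "(\<omega> t $ i)\<^sup>2 \<le> B / m $ i"
      using m_pos [of i] by (simp add: field_simps)
    then show ?thesis
      using real_le_rsqrt [of "\<bar>\<omega> t $ i\<bar>"] by simp
  qed
  then show ?thesis
    by blast
qed

lemma acceleration_bounded: "\<exists>A. \<forall>t\<ge>0. \<bar>acceleration t i\<bar> \<le> A"
proof -
  obtain V where V: "\<And>t. t \<ge> 0 \<Longrightarrow> \<bar>\<omega> t $ i\<bar> \<le> V"
    using omega_bounded by blast
  have "\<bar>acceleration t i\<bar> \<le> (\<gamma> $ i * V + (\<Sum>j\<in>UNIV. \<bar>a $ i $ j\<bar>)) / m $ i" if "t \<ge> 0" for t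
  proof -
    have "\<bar>\<gamma> $ i * \<omega> t $ i\<bar> \<le> \<gamma> $ i * V"
      using V [OF that] gamma_pos [of i] by (simp add: abs_mult)
    then have "\<bar>- \<gamma> $ i * \<omega> t $ i + coupling_force a (\<theta> t) i\<bar> \<le>
        \<gamma> $ i * V + (\<Sum>j\<in>UNIV. \<bar>a $ i $ j\<bar>)"
      using abs_coupling_force_le [of a "\<theta> t" i] by simp
    then show ?thesis
      using m_pos [of i] by (simp add: acceleration_def divide_right_mono)
  qed
  then show ?thesis
    by blast
qed

lemma energy_convergent: "\<exists>L. (energy \<longlongrightarrow> L) at_top"
proof -
  define B where "B = (\<Sum>i\<in>UNIV. \<Sum>j\<in>UNIV. \<bar>a $ i $ j\<bar>)"
  have below: "energy t \<ge> - B" for t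
    using kinetic_nonneg [of t] coherence_le [of a "\<theta> t"] by (simp add: B_def energy_def)
  define L where "L = Inf (energy ` {0..})"
  have bdd: "bdd_below (energy ` {0..})"
    using below by (intro bdd_belowI2)
  have "(energy \<longlongrightarrow> L) at_top"
  proof (rule tendstoI)
    fix e :: real
    assume "e > 0"
    then have "Inf (energy ` {0..}) < L + e"
      by (simp add: L_def)
    then obtain s where s: "s \<ge> 0" "energy s < L + e"
      using cInf_lessD [of "energy ` {0..}" "L + e"] by auto
    show "\<forall>\<^sub>F t in at_top. dist (energy t) L < e"
      using eventually_ge_at_top [of s]
    proof eventually_elim
      case (elim t)
      have "L \<le> energy t"
        unfolding L_def using elim s(1) by (intro cInf_lower bdd) auto
      then show ?case
        using energy_antimono [OF s(1) elim] s(2) by (simp add: dist_real_def)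
    qed
  qed
  then show ?thesis
    by blast
qed

text \<open>The dissipation rate is the derivative of the convergent energy, and its own derivative is
  bounded because velocities and accelerations are.\<close>

theorem omega_tendsto_zero: "((\<lambda>t. \<omega> t $ i) \<longlongrightarrow> 0) at_top"
proof -
  obtain L where L: "(energy \<longlongrightarrow> L) at_top"
    using energy_convergent by blast
  obtain V where V: "\<And>i t. t \<ge> 0 \<Longrightarrow> \<bar>\<omega> t $ i\<bar> \<le> V i"
    using omega_bounded by metis
  obtain A where A: "\<And>i t. t \<ge> 0 \<Longrightarrow> \<bar>acceleration t i\<bar> \<le> A i"
    using acceleration_bounded by metis
  have "((\<lambda>t. - 2 * (\<Sum>i\<in>UNIV. \<gamma> $ i * (\<omega> t $ i)\<^sup>2)) \<longlongrightarrow> 0) at_top"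
  proof (rule derivative_tendsto_zero [OF energy_deriv _ _ L])
    fix t :: real
    assume t: "t > 0"
    show "((\<lambda>t. - 2 * (\<Sum>i\<in>UNIV. \<gamma> $ i * (\<omega> t $ i)\<^sup>2)) has_real_derivative
        - 2 * (\<Sum>i\<in>UNIV. \<gamma> $ i * (2 * \<omega> t $ i * acceleration t i))) (at t)"
      by (intro DERIV_cmult DERIV_sum DERIV_square omega_deriv t)
    have "\<bar>\<Sum>i\<in>UNIV. \<gamma> $ i * (2 * \<omega> t $ i * acceleration t i)\<bar> \<le>
        (\<Sum>i\<in>UNIV. \<gamma> $ i * (2 * V i * A i))"
    proof (intro order_trans [OF sum_abs] sum_mono)
      fix i
      have "V i \<ge> 0"
        using V [of 0 i] by simp
      then show "\<bar>\<gamma> $ i * (2 * \<omega> t $ i * acceleration t i)\<bar> \<le> \<gamma> $ i * (2 * V i * A i)"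
        using gamma_pos [of i] V [of t i] A [of t i] t
        by (auto simp: abs_mult intro!: mult_mono)
    qed
    then show "\<bar>- 2 * (\<Sum>i\<in>UNIV. \<gamma> $ i * (2 * \<omega> t $ i * acceleration t i))\<bar> \<le>
        2 * (\<Sum>i\<in>UNIV. \<gamma> $ i * (2 * V i * A i))"
      by (simp add: abs_mult)
  qed
  then have "((\<lambda>t. - (1 / 2) * (- 2 * (\<Sum>i\<in>UNIV. \<gamma> $ i * (\<omega> t $ i)\<^sup>2))) \<longlongrightarrow> 0) at_top"
    by (rule tendsto_mult_right_zero)
  then have dissipation: "((\<lambda>t. \<Sum>i\<in>UNIV. \<gamma> $ i * (\<omega> t $ i)\<^sup>2) \<longlongrightarrow> 0) at_top"
    by simp
  have "((\<lambda>t. \<gamma> $ i * (\<omega> t $ i)\<^sup>2) \<longlongrightarrow> 0) at_top"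
  proof (rule tendsto_sandwich [OF _ _ tendsto_const dissipation])
    show "\<forall>\<^sub>F t in at_top. 0 \<le> \<gamma> $ i * (\<omega> t $ i)\<^sup>2"
      using gamma_pos by (simp add: less_imp_le)
    show "\<forall>\<^sub>F t in at_top. \<gamma> $ i * (\<omega> t $ i)\<^sup>2 \<le> (\<Sum>i\<in>UNIV. \<gamma> $ i * (\<omega> t $ i)\<^sup>2)"
      using gamma_pos by (intro always_eventually allI member_le_sum) (auto simp: less_imp_le)
  qed
  from tendsto_mult_right_zero [OF this, of "1 / \<gamma> $ i"]
  have "((\<lambda>t. (\<omega> t $ i)\<^sup>2) \<longlongrightarrow> 0) at_top"
    using gamma_pos [of i] by simp
  then show ?thesis
    by simp
qed

text \<open>The velocity converges and has a bounded second derivative, so the acceleration tends to zero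
  along with it, and the equation of motion expresses the force by these two.\<close>

theorem coupling_force_tendsto_zero: "((\<lambda>t. coupling_force a (\<theta> t) i) \<longlongrightarrow> 0) at_top"
proof -
  obtain V where V: "\<And>i t. t \<ge> 0 \<Longrightarrow> \<bar>\<omega> t $ i\<bar> \<le> V i"
    using omega_bounded by metis
  obtain A where A: "\<And>t. t \<ge> 0 \<Longrightarrow> \<bar>acceleration t i\<bar> \<le> A"
    using acceleration_bounded by blast
  define force' where "force' t =
    (\<Sum>j\<in>UNIV. a $ i $ j * (cos (\<theta> t $ j - \<theta> t $ i) * (\<omega> t $ j - \<omega> t $ i)))" for t
  define B where "B = (\<Sum>j\<in>UNIV. \<bar>a $ i $ j\<bar> * (V j + V i))"
  have "((\<lambda>t. acceleration t i) \<longlongrightarrow> 0) at_top"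
  proof (rule derivative_tendsto_zero [OF omega_deriv _ _ omega_tendsto_zero])
    fix t :: real
    assume t: "t > 0"
    show "((\<lambda>t. acceleration t i) has_real_derivative
        (- \<gamma> $ i * acceleration t i + force' t) / m $ i) (at t)"
      unfolding acceleration_def [of _ i] force'_def
      by (rule DERIV_cdivide, rule DERIV_add, rule DERIV_cmult,
          rule omega_deriv [unfolded acceleration_def, OF t], rule coupling_force_deriv [OF t])
    have "\<bar>force' t\<bar> \<le> B"
      unfolding force'_def B_def
    proof (intro order_trans [OF sum_abs] sum_mono)
      fix j
      have "\<bar>\<omega> t $ j - \<omega> t $ i\<bar> \<le> V j + V i"
        using V [of t j] V [of t i] t by simp
      then have "\<bar>cos (\<theta> t $ j - \<theta> t $ i)\<bar> * \<bar>\<omega> t $ j - \<omega> t $ i\<bar> \<le> 1 * (V j + V i)"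
        by (intro mult_mono) auto
      then show "\<bar>a $ i $ j * (cos (\<theta> t $ j - \<theta> t $ i) * (\<omega> t $ j - \<omega> t $ i))\<bar> \<le>
          \<bar>a $ i $ j\<bar> * (V j + V i)"
        by (simp add: abs_mult mult_left_mono)
    qed
    moreover have "\<bar>\<gamma> $ i * acceleration t i\<bar> \<le> \<gamma> $ i * A"
      using A [of t] t gamma_pos [of i] by (simp add: abs_mult)
    ultimately have "\<bar>- \<gamma> $ i * acceleration t i + force' t\<bar> \<le> \<gamma> $ i * A + B"
      by simp
    then show "\<bar>(- \<gamma> $ i * acceleration t i + force' t) / m $ i\<bar> \<le> (\<gamma> $ i * A + B) / m $ i"
      using m_pos [of i] by (simp add: divide_right_mono)
  qed
  then have "((\<lambda>t. m $ i * acceleration t i + \<gamma> $ i * \<omega> t $ i) \<longlongrightarrow> m $ i * 0 + \<gamma> $ i * 0) at_top"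
    by (intro tendsto_intros omega_tendsto_zero)
  moreover have "m $ i * acceleration t i + \<gamma> $ i * \<omega> t $ i = coupling_force a (\<theta> t) i" for t
    using m_pos [of i] by (simp add: acceleration_def)
  ultimately show ?thesis
    by simp
qed

lemma phase_difference_tendsto_multiple_pi:
  assumes R: "R > 0" "\<And>t. t \<ge> 0 \<Longrightarrow> local_order_parameter a (\<theta> t) i \<ge> R"
    and \<phi>: "local_average_phase a \<theta> i \<phi>"
  shows "\<exists>k::int. ((\<lambda>t. \<theta> t $ i - \<phi> t) \<longlongrightarrow> of_int k * pi) at_top"
proof (rule continuous_sin_tendsto_zero_imp_tendsto_multiple_pi)
  show "continuous_on {0..} (\<lambda>t. \<theta> t $ i - \<phi> t)"
    using \<phi> by (intro continuous_intros theta_continuous) (simp add: local_average_phase_def)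
  have lim: "((\<lambda>t. (1 / R) * coupling_force a (\<theta> t) i) \<longlongrightarrow> 0) at_top"
    by (rule tendsto_mult_right_zero [OF coupling_force_tendsto_zero])
  show "((\<lambda>t. sin (\<theta> t $ i - \<phi> t)) \<longlongrightarrow> 0) at_top"
  proof (rule Lim_null_comparison [OF _ tendsto_rabs_zero [OF lim]])
    show "\<forall>\<^sub>F t in at_top. norm (sin (\<theta> t $ i - \<phi> t)) \<le> \<bar>(1 / R) * coupling_force a (\<theta> t) i\<bar>"
      using eventually_ge_at_top [of 0]
    proof eventually_elim
      case (elim t)
      have "R * \<bar>sin (\<theta> t $ i - \<phi> t)\<bar> \<le> local_order_parameter a (\<theta> t) i * \<bar>sin (\<theta> t $ i - \<phi> t)\<bar>"
        by (intro mult_right_mono R(2) elim) simp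
      also have "\<dots> = \<bar>coupling_force a (\<theta> t) i\<bar>"
        using local_average_phase_sin [OF \<phi> elim] R(1) R(2) [OF elim] by (simp add: abs_mult)
      finally show ?case
        using R(1) by (simp add: field_simps abs_mult)
    qed
  qed
qed

section \<open>Equilibria\<close>

text \<open>This is uniqueness of solutions at an equilibrium.  The squared distance \<open>X + W\<close> to it in phase
  space starts at zero; since the forces vanish there and are Lipschitz in the phases, its derivative
  is bounded by a multiple of itself.  The damping term has the favourable sign.\<close>

lemma equilibrium_stationary:
  assumes "\<omega> 0 = 0" "\<And>i. coupling_force a (\<theta> 0) i = 0" "t \<ge> 0"
  shows "\<theta> t = \<theta> 0"
proof -
  define X where "X t = (\<Sum>i\<in>UNIV. (\<theta> t $ i - \<theta> 0 $ i)\<^sup>2)" for t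
  define W where "W t = (\<Sum>i\<in>UNIV. (\<omega> t $ i)\<^sup>2)" for t
  define B where "B = (\<Sum>i\<in>UNIV. \<Sum>j\<in>UNIV. \<bar>a $ i $ j\<bar> / m $ i)"
  have X_ge: "(\<theta> t $ i - \<theta> 0 $ i)\<^sup>2 \<le> X t" for i t
    unfolding X_def by (rule member_le_sum) auto
  have W_ge: "(\<omega> t $ i)\<^sup>2 \<le> W t" for i t
    unfolding W_def by (rule member_le_sum) auto
  have nonneg: "X t \<ge> 0" "W t \<ge> 0" for t
    by (simp_all add: X_def W_def sum_nonneg)
  have "X t + W t = 0"
  proof (rule gronwall_zero [where u = "\<lambda>t. X t + W t" and C = "1 + 2 * B"])
    show "continuous_on {0..} (\<lambda>t. X t + W t)"
      unfolding X_def W_def by (intro continuous_intros theta_continuous omega_continuous)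
    show "X 0 + W 0 = 0"
      using assms by (simp add: X_def W_def)
    fix t :: real
    assume t: "t > 0"
    have "((\<lambda>t. \<theta> t $ i - \<theta> 0 $ i) has_real_derivative \<omega> t $ i) (at t)" for i
      using DERIV_diff [OF theta_deriv [OF t] DERIV_const] by simp
    then show "((\<lambda>t. X t + W t) has_real_derivative
        (\<Sum>i\<in>UNIV. 2 * (\<theta> t $ i - \<theta> 0 $ i) * \<omega> t $ i) +
        (\<Sum>i\<in>UNIV. 2 * \<omega> t $ i * acceleration t i)) (at t)"
      unfolding X_def W_def
      by (intro DERIV_add DERIV_sum DERIV_square omega_deriv t)
    have "(\<Sum>i\<in>UNIV. 2 * (\<theta> t $ i - \<theta> 0 $ i) * \<omega> t $ i) \<le> X t + W t"
      unfolding X_def W_def sum.distrib [symmetric]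
      by (intro sum_mono sum_squares_bound)
    moreover have "2 * \<omega> t $ i * acceleration t i \<le>
        (\<Sum>j\<in>UNIV. \<bar>a $ i $ j\<bar> / m $ i) * (2 * (X t + W t))" for i
    proof -
      have "2 * (\<omega> t $ i) * coupling_force a (\<theta> t) i \<le> 2 * \<bar>\<omega> t $ i\<bar> * \<bar>coupling_force a (\<theta> t) i\<bar>"
        using abs_ge_self [of "2 * (\<omega> t $ i) * coupling_force a (\<theta> t) i"] by (simp add: abs_mult)
      also have "\<dots> \<le> 2 * \<bar>\<omega> t $ i\<bar> *
          (\<Sum>j\<in>UNIV. \<bar>a $ i $ j\<bar> * (\<bar>\<theta> t $ j - \<theta> 0 $ j\<bar> + \<bar>\<theta> t $ i - \<theta> 0 $ i\<bar>))"
        using abs_coupling_force_diff_le [of a "\<theta> t" i "\<theta> 0"] assms(2)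
        by (intro mult_left_mono) auto
      also have "\<dots> = (\<Sum>j\<in>UNIV. \<bar>a $ i $ j\<bar> *
          (2 * \<bar>\<omega> t $ i\<bar> * \<bar>\<theta> t $ j - \<theta> 0 $ j\<bar> + 2 * \<bar>\<omega> t $ i\<bar> * \<bar>\<theta> t $ i - \<theta> 0 $ i\<bar>))"
        by (simp add: sum_distrib_left algebra_simps)
      also have "\<dots> \<le> (\<Sum>j\<in>UNIV. \<bar>a $ i $ j\<bar> * (2 * (X t + W t)))"
      proof (intro sum_mono mult_left_mono)
        fix j
        have young: "2 * \<bar>\<omega> t $ i\<bar> * \<bar>\<theta> t $ l - \<theta> 0 $ l\<bar> \<le> X t + W t" for l
          using sum_squares_bound [of "\<bar>\<omega> t $ i\<bar>" "\<bar>\<theta> t $ l - \<theta> 0 $ l\<bar>"]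
            X_ge [of t l] W_ge [of t i] by simp
        show "2 * \<bar>\<omega> t $ i\<bar> * \<bar>\<theta> t $ j - \<theta> 0 $ j\<bar> + 2 * \<bar>\<omega> t $ i\<bar> * \<bar>\<theta> t $ i - \<theta> 0 $ i\<bar> \<le>
            2 * (X t + W t)"
          using add_mono [OF young [of j] young [of i]] by (simp only: mult_2)
      qed simp
      finally have "2 * (\<omega> t $ i) * coupling_force a (\<theta> t) i \<le>
          (\<Sum>j\<in>UNIV. \<bar>a $ i $ j\<bar>) * (2 * (X t + W t))"
        by (simp add: sum_distrib_right)
      moreover have "0 \<le> 2 * (\<gamma> $ i * (\<omega> t $ i)\<^sup>2)"
        using gamma_pos [of i] by simp
      ultimately have "(2 * (\<omega> t $ i) * coupling_force a (\<theta> t) i - 2 * (\<gamma> $ i * (\<omega> t $ i)\<^sup>2)) / m $ i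
          \<le> (\<Sum>j\<in>UNIV. \<bar>a $ i $ j\<bar>) * (2 * (X t + W t)) / m $ i"
        using m_pos [of i] by (intro divide_right_mono) auto
      moreover have "2 * \<omega> t $ i * acceleration t i =
          (2 * (\<omega> t $ i) * coupling_force a (\<theta> t) i - 2 * (\<gamma> $ i * (\<omega> t $ i)\<^sup>2)) / m $ i"
        by (simp add: acceleration_def power2_eq_square algebra_simps)
      ultimately show ?thesis
        by (simp add: sum_divide_distrib [symmetric])
    qed
    then have "(\<Sum>i\<in>UNIV. 2 * \<omega> t $ i * acceleration t i) \<le>
        (\<Sum>i\<in>UNIV. (\<Sum>j\<in>UNIV. \<bar>a $ i $ j\<bar> / m $ i) * (2 * (X t + W t)))"
      by (rule sum_mono)
    then have "(\<Sum>i\<in>UNIV. 2 * \<omega> t $ i * acceleration t i) \<le> B * (2 * (X t + W t))"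
      by (simp only: B_def sum_distrib_right)
    ultimately show "(\<Sum>i\<in>UNIV. 2 * (\<theta> t $ i - \<theta> 0 $ i) * \<omega> t $ i) +
        (\<Sum>i\<in>UNIV. 2 * \<omega> t $ i * acceleration t i) \<le> (1 + 2 * B) * (X t + W t)"
      by (simp add: algebra_simps)
  qed (use nonneg assms(3) in auto)
  then have "X t \<le> 0"
    using nonneg [of t] by linarith
  then have "(\<theta> t $ i - \<theta> 0 $ i)\<^sup>2 \<le> 0" for i
    using X_ge [of t i] by linarith
  then show ?thesis
    by (simp add: vec_eq_iff)
qed

end

section \<open>Emergence of synchronization\<close>

theorem theorem3p5:
  fixes a :: "real ^ 'n ^ 'n"
    and m \<gamma> \<theta>in \<omega>in :: "real ^ 'n"
    and abar \<delta> :: real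
    and \<theta> \<omega> :: "real \<Rightarrow> real ^ 'n"
  assumes a_sym: "transpose a = a"
    and a_nonneg: "\<And>i j. a $ i $ j \<ge> 0"
    and abar_pos: "abar > 0"
    and delta_nonneg: "\<delta> \<ge> 0"
    and m_pos: "\<And>i. m $ i > 0"
    and gamma_pos: "\<And>i. \<gamma> $ i > 0"
    and a_near: "\<And>i. (\<Sum>j\<in>UNIV. \<bar>a $ i $ j - abar\<bar>) \<le> \<delta>"
    and energy: "(\<Sum>i\<in>UNIV. \<Sum>j\<in>UNIV. a $ i $ j * cos (\<theta>in $ i - \<theta>in $ j)) \<ge>
      (\<Sum>i\<in>UNIV. m $ i * \<bar>\<omega>in $ i\<bar>\<^sup>2) + 3 * \<delta> * real CARD('n) + \<delta>\<^sup>2 / abar"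
    and solution: "inertial_kuramoto_solution m \<gamma> a \<theta>in \<omega>in \<theta> \<omega>"
  shows "(\<forall>i j. ((\<lambda>t. \<bar>\<omega> t $ i - \<omega> t $ j\<bar>) \<longlongrightarrow> 0) at_top) \<and>
    ((\<Sum>i\<in>UNIV. \<Sum>j\<in>UNIV. a $ i $ j * cos (\<theta>in $ i - \<theta>in $ j)) = 0 \<longrightarrow>
      phase_locked \<theta> \<and> (\<forall>t\<ge>0. \<forall>i. local_order_parameter a (\<theta> t) i = 0)) \<and>
    ((\<Sum>i\<in>UNIV. \<Sum>j\<in>UNIV. a $ i $ j * cos (\<theta>in $ i - \<theta>in $ j)) > 0 \<longrightarrow>
      (\<exists>R>0. \<forall>t\<ge>0. \<forall>i. local_order_parameter a (\<theta> t) i \<ge> R) \<and>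
      (\<forall>i \<phi>. local_average_phase a \<theta> i \<phi> \<longrightarrow>
        (\<exists>k::int. ((\<lambda>t. \<theta> t $ i - \<phi> t) \<longlongrightarrow> of_int k * pi) at_top)))"
proof -
  have init: "\<theta>in = \<theta> 0" "\<omega>in = \<omega> 0"
    using solution by (auto simp: inertial_kuramoto_solution_def)
  have sym: "a $ i $ j = a $ j $ i" for i j
    using arg_cong [OF a_sym, of "\<lambda>b. b $ j $ i"] by (simp add: transpose_def)
  interpret flow: inertial_kuramoto m \<gamma> a \<theta> \<omega>
    using sym m_pos gamma_pos solution unfolding init by unfold_locales
  have energy0: "flow.energy 0 \<le> - (3 * \<delta> * real CARD('n) + \<delta>\<^sup>2 / abar)"
    using energy by (simp add: flow.energy_def coherence_def init)
  have slack: "0 \<le> 3 * \<delta> * real CARD('n)" "0 \<le> \<delta>\<^sup>2 / abar"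
    using delta_nonneg abar_pos by auto
  have "((\<lambda>t. \<bar>\<omega> t $ i - \<omega> t $ j\<bar>) \<longlongrightarrow> 0) at_top" for i j
    using tendsto_rabs [OF tendsto_diff [OF flow.omega_tendsto_zero [of i] flow.omega_tendsto_zero [of j]]]
    by simp
  moreover have "phase_locked \<theta> \<and> (\<forall>t\<ge>0. \<forall>i. local_order_parameter a (\<theta> t) i = 0)"
    if "coherence a (\<theta> 0) = 0"
  proof -
    have balance: "(\<Sum>i\<in>UNIV. m $ i * (\<omega> 0 $ i)\<^sup>2) + 3 * \<delta> * real CARD('n) + \<delta>\<^sup>2 / abar \<le> 0"
      using energy0 that by (simp add: flow.energy_def)
    then have kin: "(\<Sum>i\<in>UNIV. m $ i * (\<omega> 0 $ i)\<^sup>2) \<le> 0"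
      using slack by linarith
    have "\<delta>\<^sup>2 / abar \<le> 0"
      using balance slack flow.kinetic_nonneg [of 0] by linarith
    then have delta: "\<delta> = 0"
      using abar_pos by (simp add: divide_le_0_iff)
    have nonneg: "0 \<le> m $ i * (\<omega> 0 $ i)\<^sup>2" for i
      using m_pos [of i] by simp
    have "(\<Sum>i\<in>UNIV. m $ i * (\<omega> 0 $ i)\<^sup>2) = 0"
      using kin flow.kinetic_nonneg [of 0] by (rule antisym)
    then have "m $ i * (\<omega> 0 $ i)\<^sup>2 = 0" for i
      by (simp only: sum_nonneg_eq_0_iff [OF finite nonneg] ball_UNIV)
    moreover have "m $ i \<noteq> 0" for i
      using m_pos [of i] by simp
    ultimately have rest: "\<omega> 0 = 0"
      by (simp add: vec_eq_iff)
    have near: "(\<Sum>j\<in>UNIV. \<bar>a $ i $ j - abar\<bar>) \<le> 0" for i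
      using a_near [of i] delta by simp
    have "mean_field (\<theta> 0) = 0"
      using coherence_near_mean_field [OF near, of "\<theta> 0"] that abar_pos
      by (simp add: mult_le_0_iff)
    then have field: "local_field a (\<theta> 0) i = 0" for i
      using local_field_near_mean_field [where x = "\<theta> 0" and i = i, OF near] by simp
    then have "coupling_force a (\<theta> 0) i = 0" for i
      using rotated_local_field [of "\<theta> 0" i a] by (simp add: complex_eq_iff)
    from flow.equilibrium_stationary [OF rest this]
    have stationary: "\<theta> t = \<theta> 0" if "t \<ge> 0" for t
      using that by blast
    have "phase_locked \<theta>"
      unfolding phase_locked_def by (metis stationary)
    moreover have "local_order_parameter a (\<theta> t) i = 0" if "t \<ge> 0" for t i
      unfolding stationary [OF that] local_order_parameter_def by (simp add: field)
    ultimately show ?thesis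
      by blast
  qed
  moreover have "(\<exists>R>0. \<forall>t\<ge>0. \<forall>i. local_order_parameter a (\<theta> t) i \<ge> R) \<and>
      (\<forall>i \<phi>. local_average_phase a \<theta> i \<phi> \<longrightarrow>
        (\<exists>k::int. ((\<lambda>t. \<theta> t $ i - \<phi> t) \<longlongrightarrow> of_int k * pi) at_top))"
    if pos: "coherence a (\<theta> 0) > 0"
  proof -
    \<comment> \<open>For \<open>\<delta> > 0\<close> the margin \<open>3 \<delta> N\<close> leaves \<open>2 \<delta> N\<close> beyond what the comparison with the mean
      field costs; for \<open>\<delta> = 0\<close> there is no margin and the dissipation has to provide it.\<close>
    obtain c where c: "c > 0"
      "\<And>t. t \<ge> 0 \<Longrightarrow> coherence a (\<theta> t) \<ge> \<delta> * real CARD('n) + \<delta>\<^sup>2 / abar + c"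
    proof (cases "\<delta> = 0")
      case True
      have "flow.energy 0 \<le> 0"
        using energy0 slack by linarith
      from flow.coherence_bounded_below [OF this pos] show thesis
        using that True by auto
    next
      case False
      have "2 * \<delta> * real CARD('n) > 0"
        using False delta_nonneg by simp
      moreover have "coherence a (\<theta> t) \<ge>
          \<delta> * real CARD('n) + \<delta>\<^sup>2 / abar + 2 * \<delta> * real CARD('n)" if "t \<ge> 0" for t
      proof -
        have "coherence a (\<theta> t) \<ge> - flow.energy t"
          using flow.kinetic_nonneg [of t] by (simp add: flow.energy_def)
        then show ?thesis
          using energy0 flow.energy_antimono [OF order_refl \<open>t \<ge> 0\<close>] by linarith
      qed
      ultimately show thesis
        by (rule that)
    qed
    define R where "R = sqrt (\<delta>\<^sup>2 + abar * c) - \<delta>"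
    have "\<delta>\<^sup>2 < \<delta>\<^sup>2 + abar * c"
      using abar_pos c(1) by simp
    from real_less_rsqrt [OF this] have "R > 0"
      by (simp add: R_def)
    moreover have "local_order_parameter a (\<theta> t) i \<ge> R" if "t \<ge> 0" for t i
      unfolding R_def using abar_pos delta_nonneg less_imp_le [OF c(1)] a_near c(2) [OF that]
      by (rule local_order_parameter_lower_bound)
    ultimately show ?thesis
      using flow.phase_difference_tendsto_multiple_pi by blast
  qed
  ultimately show ?thesis
    unfolding init coherence_def by blast
qed

end
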